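(* For every $\alpha>0$ and every $\tau\in[\tfrac13,\tfrac23)$ there exists $\beta=\beta(\alpha,\tau)>0$ such that every set $A$ of $n$ points in general position in $\mathbb{R}^3$ satisfying $\Delta(A)\le \alpha n^{\tau}$ contains a subset of $\beta n^{1-3\tau/2}$ points in convex position.
   Context: A finite set of points in $\mathbb{R}^3$ is in general position if any $4$ or fewer of its points are affinely independent, and in convex position if no point lies in the convex hull of the others. For a finite set $A$ the spread $\Delta(A)$ is the ratio of the maximum pairwise Euclidean distance to the minimum pairwise Euclidean distance among points of $A$. *)

theory Defs
  imports "HOL-Analysis.Analysis"
begin

definition general_position :: "(real ^ 3) set \<Rightarrow> bool" where
  "general_position A \<longleftrightarrow> finite A \<and> (\<forall>S \<subseteq> A. card S \<le> 4 \<longrightarrow> \<not> affine_dependent S)"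

definition convex_position :: "(real ^ 3) set \<Rightarrow> bool" where
  "convex_position A \<longleftrightarrow> finite A \<and> (\<forall>p \<in> A. p \<notin> convex hull (A - {p}))"

(* Meaningful only for finite A with at least two points: otherwise Max and Min
   are applied to an empty set and the value is unspecified. *)
definition spread :: "(real ^ 3) set \<Rightarrow> real" where
  "spread A =
     Max {dist x y | x y. x \<in> A \<and> y \<in> A \<and> x \<noteq> y} /
     Min {dist x y | x y. x \<in> A \<and> y \<in> A \<and> x \<noteq> y}"

end

theory Submission
  imports Defs
begin

text \<open>
  Scale so that distances are at least \<open>11\<close> and the points lie in \<open>[0, D]\<^sup>3\<close> with \<open>D = r\<^sup>4\<close>
  comparable to the spread. Cut the plane into tiles of side \<open>r\<close> and translate the points by
  \<open>(ri, rj, 0)\<close> with \<open>i, j < M \<approx> D/r\<close>. Over each tile, measure heights above the tangent plane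
  of the paraboloid \<open>D z = x\<^sup>2 + y\<^sup>2\<close> at the corner of the tile and cut them into levels of
  (\<open>D\<close>-scaled) height \<open>r\<^sup>2\<close>. The cells of one level over tiles that are at least three apart lie
  in disjoint caps of one convex surface, so one point from each of them gives a set in convex position.
  There are \<open>O(r\<^sup>6) = O(D powr (3/2))\<close> levels, so it suffices to find a shift for which the
  points occupy at least a constant times \<open>n\<close> cells, and by Cauchy--Schwarz it suffices that
  only \<open>O(n)\<close> pairs share a cell. This holds on average over the shifts: two points with
  horizontal distance \<open>w\<close> share a cell only if their difference is almost parallel to the
  tangent plane, which happens for \<open>O(M r / w)\<close> of the \<open>M\<^sup>2\<close> shifts, and by packing
  the sum of \<open>1 / w\<close> over all candidates within a tile is \<open>O(r\<^sup>2)\<close>; finally \<open>M r\<^sup>3 \<le> M\<^sup>2\<close>.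
\<close>

text \<open>
  \<open>D\<close> times the height of the translate \<open>q + (ri, rj, 0)\<close> above the plane that is tangent to
  \<open>D z = x\<^sup>2 + y\<^sup>2\<close> over \<open>(r(k + i), r(l + j))\<close>, where \<open>D = r\<^sup>4\<close>. If \<open>(k, l)\<close> is the tile
  of \<open>q\<close>, this point is the corner of the tile of the translate.
\<close>

definition tangent_height :: "real \<Rightarrow> int \<Rightarrow> int \<Rightarrow> nat \<Rightarrow> nat \<Rightarrow> real ^ 3 \<Rightarrow> real" where
  "tangent_height r k l i j q =
     r ^ 4 * q $ 3
     - 2 * (r * (k + i)) * (q $ 1 + r * i) + (r * (k + i))\<^sup>2
     - 2 * (r * (l + j)) * (q $ 2 + r * j) + (r * (l + j))\<^sup>2"

text \<open>The tile is read off from the untranslated point: a translation by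
  \<open>(ri, rj, 0)\<close> moves every tile index by \<open>(i, j)\<close>, so it does not change
  which points share a tile. Only the level depends on the shift.\<close>

definition cap_label :: "real \<Rightarrow> nat \<Rightarrow> nat \<Rightarrow> real ^ 3 \<Rightarrow> int \<times> int \<times> int" where
  "cap_label r i j p =
     (let k = \<lfloor>p $ 1 / r\<rfloor>; l = \<lfloor>p $ 2 / r\<rfloor>
      in (k, l, \<lfloor>tangent_height r k l i j p / r\<^sup>2\<rfloor>))"

section \<open>Separation criterion and scaling for convex position\<close>

lemma convex_position_if_separated:
  fixes B :: "(real ^ 3) set"
  assumes "finite B"
    and sep: "\<And>p. p \<in> B \<Longrightarrow> \<exists>v c. v \<bullet> p < c \<and> (\<forall>q \<in> B - {p}. c \<le> v \<bullet> q)"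
  shows "convex_position B"
  unfolding convex_position_def
proof (intro conjI ballI notI)
  fix p assume "p \<in> B" and hull: "p \<in> convex hull (B - {p})"
  then obtain v c where v: "v \<bullet> p < c" "\<forall>q \<in> B - {p}. c \<le> v \<bullet> q"
    using sep by blast
  have "convex hull (B - {p}) \<subseteq> {x. v \<bullet> x \<ge> c}"
    using v(2) by (intro hull_minimal convex_halfspace_ge) auto
  then show False using hull v(1) by auto
qed (fact assms(1))

text \<open>Convex hulls commute with injective affine maps. This carries the subset found in
  normalised coordinates back to the original points.\<close>

lemma convex_position_of_affine_image:
  fixes B :: "(real ^ 3) set"
  assumes "convex_position ((\<lambda>x. s *\<^sub>R (x - a)) ` B)" and "s \<noteq> 0"
  shows "convex_position B"
proof -
  let ?T = "\<lambda>x. s *\<^sub>R (x - a)"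
  have inj: "inj_on ?T X" for X using assms(2) by (auto simp: inj_on_def)
  have T: "?T = (\<lambda>x. (- s *\<^sub>R a) + s *\<^sub>R x)" by (auto simp: algebra_simps)
  show ?thesis
    unfolding convex_position_def
  proof (intro conjI ballI notI)
    show "finite B"
      using assms(1) unfolding convex_position_def finite_image_iff[OF inj] by (rule conjunct1)
    fix p assume p: "p \<in> B" and hull: "p \<in> convex hull (B - {p})"
    have "?T p \<in> ?T ` (convex hull (B - {p}))" using hull by blast
    also have "\<dots> = convex hull (?T ` (B - {p}))"
      unfolding T by (rule convex_hull_affinity[symmetric])
    also have "?T ` (B - {p}) = ?T ` B - {?T p}"
      using inj[of UNIV] by (auto simp: inj_on_def)
    finally show False using assms(1) p unfolding convex_position_def by blast
  qed
qed

section \<open>Tangent heights and caps over sparse tiles\<close>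

text \<open>For a fixed tile and shift the level sets of the height are parallel planes, which serve
  as separating planes; \<open>v\<close> is their normal.\<close>

lemma tangent_height_affine:
  "\<exists>v d. \<forall>q. tangent_height r k l i j q = v \<bullet> q + d"
proof (intro exI allI)
  fix q :: "real ^ 3"
  show "tangent_height r k l i j q =
      (vector [- 2 * (r * (k + i)), - 2 * (r * (l + j)), r ^ 4] :: real ^ 3) \<bullet> q +
      ((r * (k + i))\<^sup>2 + (r * (l + j))\<^sup>2 - 2 * (r * (k + i)) * (r * i) - 2 * (r * (l + j)) * (r * j))"
    unfolding tangent_height_def inner_vec_def sum_3 vector_3 inner_real_def
    by (simp add: algebra_simps)
qed

text \<open>Completing the squares: the first three terms measure the height above the paraboloid
  itself and do not involve the tile, and the last two are the squared horizontal distance to the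
  tile corner, where the shift cancels. Changing the tile thus changes only this distance.\<close>

lemma tangent_height_alt:
  "tangent_height r k l i j q =
     r ^ 4 * q $ 3 - (q $ 1 + r * i)\<^sup>2 - (q $ 2 + r * j)\<^sup>2 + (q $ 1 - r * k)\<^sup>2 + (q $ 2 - r * l)\<^sup>2"
  unfolding tangent_height_def by (simp add: power2_eq_square algebra_simps)

lemma floor_divide_bounds:
  fixes x r :: real
  assumes "r > 0"
  shows "r * \<lfloor>x / r\<rfloor> \<le> x" "x < r * \<lfloor>x / r\<rfloor> + r"
proof -
  have "r * \<lfloor>x / r\<rfloor> \<le> r * (x / r)"
    using assms by (intro mult_left_mono) auto
  moreover have "r * (x / r) < r * (\<lfloor>x / r\<rfloor> + 1)"
    using assms by (intro mult_strict_left_mono) linarith+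
  ultimately show "r * \<lfloor>x / r\<rfloor> \<le> x" "x < r * \<lfloor>x / r\<rfloor> + r"
    using assms by (simp_all add: distrib_left)
qed

text \<open>Distinct indices that agree modulo 3 differ by at least 3. The point lies up to one tile
  width to the right of the left edge of its own tile, so 2 widths remain when its tile is to the
  left.\<close>

lemma square_dist_far_tile:
  fixes x r :: real and k :: int
  assumes r: "r > 0" and "\<lfloor>x / r\<rfloor> \<noteq> k" and "\<lfloor>x / r\<rfloor> mod 3 = k mod 3"
  shows "(x - r * k)\<^sup>2 \<ge> 4 * r\<^sup>2"
proof -
  let ?m = "\<lfloor>x / r\<rfloor>"
  have "?m \<ge> k + 3 \<or> ?m \<le> k - 3" using assms(2,3) by presburger
  then have "\<bar>x - r * k\<bar> \<ge> 2 * r"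
  proof
    assume "?m \<ge> k + 3"
    then have "real_of_int ?m \<ge> k + 3" by linarith
    then have "r * ?m \<ge> r * (k + 3)" using r by (intro mult_left_mono) auto
    then show ?thesis using floor_divide_bounds[OF r, of x] r by (simp add: algebra_simps)
  next
    assume "?m \<le> k - 3"
    then have "real_of_int ?m \<le> k - 3" by linarith
    then have "r * ?m \<le> r * (k - 3)" using r by (intro mult_left_mono) auto
    then show ?thesis using floor_divide_bounds[OF r, of x] r by (simp add: algebra_simps)
  qed
  then have "(2 * r)\<^sup>2 \<le> \<bar>x - r * k\<bar>\<^sup>2" using r by (intro power_mono) auto
  then show ?thesis by (simp add: power_mult_distrib)
qed

lemma square_dist_own_tile:
  fixes x r :: real
  assumes "r > 0"
  shows "(x - r * \<lfloor>x / r\<rfloor>)\<^sup>2 \<le> r\<^sup>2"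
  using floor_divide_bounds[OF assms, of x] by (intro power_mono) auto

text \<open>Separate \<open>p\<close> from the rest by the plane of height
  \<open>(m + 1) * r\<^sup>2\<close> over the tile of \<open>p\<close>. Another point
  \<open>q\<close> has height at least \<open>m * r\<^sup>2\<close> over its own tile, and measuring
  it from the tangent plane of \<open>p\<close> instead gains at least
  \<open>4 * r\<^sup>2 - 2 * r\<^sup>2\<close>.\<close>

lemma convex_position_same_level:
  fixes B :: "(real ^ 3) set"
  assumes r: "r > 0" and fin: "finite B"
    and inj: "inj_on (cap_label r i j) B"
    and same: "\<And>p. p \<in> B \<Longrightarrow> \<lfloor>p $ 1 / r\<rfloor> mod 3 = s \<and> \<lfloor>p $ 2 / r\<rfloor> mod 3 = t
                 \<and> snd (snd (cap_label r i j p)) = m"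
  shows "convex_position B"
proof (rule convex_position_if_separated[OF fin])
  fix p assume p: "p \<in> B"
  let ?k = "\<lfloor>p $ 1 / r\<rfloor>" and ?l = "\<lfloor>p $ 2 / r\<rfloor>"
  let ?h = "tangent_height r ?k ?l i j"
  obtain v d where vd: "\<And>q. ?h q = v \<bullet> q + d" using tangent_height_affine by blast
  have "\<lfloor>?h p / r\<^sup>2\<rfloor> = m" using same[OF p] by (simp add: cap_label_def Let_def)
  then have "?h p / r\<^sup>2 < m + 1" by linarith
  then have hp: "?h p < (m + 1) * r\<^sup>2" using r by (simp add: divide_simps)
  moreover have "(m + 1) * r\<^sup>2 \<le> ?h q" if q: "q \<in> B - {p}" for q
  proof -
    let ?k' = "\<lfloor>q $ 1 / r\<rfloor>" and ?l' = "\<lfloor>q $ 2 / r\<rfloor>"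
    let ?h' = "tangent_height r ?k' ?l' i j"
    have "\<lfloor>?h' q / r\<^sup>2\<rfloor> = m" using same[of q] q by (simp add: cap_label_def Let_def)
    then have "m \<le> ?h' q / r\<^sup>2" by linarith
    then have hq: "m * r\<^sup>2 \<le> ?h' q" using r by (simp add: divide_simps)
    \<comment> \<open>The levels agree, so distinct labels mean distinct tiles; one differing index
      suffices below.\<close>
    have "cap_label r i j q \<noteq> cap_label r i j p" using inj p q by (auto simp: inj_on_def)
    moreover have "cap_label r i j q = (?k', ?l', m)" "cap_label r i j p = (?k, ?l, m)"
      using same[of q] same[OF p] q by (simp_all add: cap_label_def Let_def)
    ultimately have "?k' \<noteq> ?k \<or> ?l' \<noteq> ?l" by metis
    then have "(q $ 1 - r * ?k)\<^sup>2 \<ge> 4 * r\<^sup>2 \<or> (q $ 2 - r * ?l)\<^sup>2 \<ge> 4 * r\<^sup>2"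
      using square_dist_far_tile[OF r] same[of q] same[OF p] q by auto
    then have "(q $ 1 - r * ?k)\<^sup>2 + (q $ 2 - r * ?l)\<^sup>2 \<ge> 4 * r\<^sup>2"
      using zero_le_power2[of "q $ 1 - r * ?k"] zero_le_power2[of "q $ 2 - r * ?l"] by linarith
    moreover have "(q $ 1 - r * ?k')\<^sup>2 \<le> r\<^sup>2" "(q $ 2 - r * ?l')\<^sup>2 \<le> r\<^sup>2"
      using square_dist_own_tile[OF r] by auto
    ultimately have "?h q \<ge> ?h' q + 2 * r\<^sup>2" unfolding tangent_height_alt by linarith
    moreover have "(m + 1) * r\<^sup>2 = m * r\<^sup>2 + r\<^sup>2" by (simp add: algebra_simps)
    moreover have "r\<^sup>2 \<ge> 0" by simp
    ultimately show ?thesis using hq by linarith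
  qed
  ultimately show "\<exists>v c. v \<bullet> p < c \<and> (\<forall>q\<in>B - {p}. c \<le> v \<bullet> q)"
    by (intro exI[of _ v] exI[of _ "(m + 1) * r\<^sup>2 - d"]) (auto simp: vd algebra_simps)
qed

text \<open>The translates have horizontal coordinates in \<open>[0, 2 * r ^ 4]\<close>, so each
  square subtracted is at most \<open>4 * r ^ 8\<close>; the positive terms are at most
  \<open>r ^ 8 + 2 * r\<^sup>2\<close>. Levels have height \<open>r\<^sup>2\<close>, hence the order
  \<open>r ^ 6\<close>.\<close>

lemma tangent_height_level_bounds:
  fixes p :: "real ^ 3"
  assumes r: "r \<ge> 1" and box: "\<And>c. 0 \<le> p $ c \<and> p $ c \<le> r ^ 4"
    and ij: "real i \<le> r ^ 3" "real j \<le> r ^ 3"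
  shows "snd (snd (cap_label r i j p)) \<in> {\<lfloor>- 8 * r ^ 6\<rfloor>..\<lfloor>3 * r ^ 6\<rfloor>}"
proof -
  let ?k = "\<lfloor>p $ 1 / r\<rfloor>" and ?l = "\<lfloor>p $ 2 / r\<rfloor>"
  let ?h = "tangent_height r ?k ?l i j p"
  have r0: "r > 0" using r by simp
  have r8: "r ^ 8 = r ^ 4 * r ^ 4" by simp
  have r4: "r * r ^ 3 = r ^ 4" by (simp add: eval_nat_numeral)
  have shift: "0 \<le> x + r * t \<and> x + r * t \<le> 2 * r ^ 4" if "0 \<le> x" "x \<le> r ^ 4" "0 \<le> t" "t \<le> r ^ 3" for x t
  proof -
    have "r * t \<le> r ^ 4" using mult_left_mono[OF that(4), of r] r r4 by simp
    moreover have "0 \<le> r * t" using that r by simp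
    ultimately show ?thesis using that by linarith
  qed
  have sq: "(x + r * t)\<^sup>2 \<le> 4 * r ^ 8" if "0 \<le> x" "x \<le> r ^ 4" "0 \<le> t" "t \<le> r ^ 3" for x t
  proof -
    have "(x + r * t)\<^sup>2 \<le> (2 * r ^ 4)\<^sup>2" using shift[OF that] by (intro power_mono) auto
    then show ?thesis by (simp add: power_mult_distrib flip: power_mult)
  qed
  have z: "0 \<le> r ^ 4 * p $ 3"
    using box[of 3] by simp
  have z': "r ^ 4 * p $ 3 \<le> r ^ 8"
    unfolding r8 by (rule mult_left_mono) (use box[of 3] in auto)
  have r2: "r\<^sup>2 \<le> r ^ 8" using r by (intro power_increasing) auto
  have own: "(p $ 1 - r * ?k)\<^sup>2 \<le> r\<^sup>2" "(p $ 2 - r * ?l)\<^sup>2 \<le> r\<^sup>2"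
    using square_dist_own_tile[OF r0] by auto
  have "?h \<le> 3 * r ^ 8"
    unfolding tangent_height_alt using z' own r2
      zero_le_power2[of "p $ 1 + r * i"] zero_le_power2[of "p $ 2 + r * j"] by linarith
  then have "?h / r\<^sup>2 \<le> 3 * r ^ 6" using r0 by (simp add: pos_divide_le_eq mult.assoc)
  moreover have "(p $ 1 + r * i)\<^sup>2 \<le> 4 * r ^ 8" "(p $ 2 + r * j)\<^sup>2 \<le> 4 * r ^ 8"
    using box ij by (auto intro: sq)
  then have "?h \<ge> - 8 * r ^ 8"
    unfolding tangent_height_alt using z
      zero_le_power2[of "p $ 1 - r * ?k"] zero_le_power2[of "p $ 2 - r * ?l"] by linarith
  then have "?h / r\<^sup>2 \<ge> - 8 * r ^ 6" using r0 by (simp add: pos_le_divide_eq mult.assoc)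
  ultimately show ?thesis by (simp add: cap_label_def Let_def floor_mono)
qed

section \<open>Counting cells and extracting a convex subset\<close>

lemma large_fibre_exists:
  fixes f :: "'a \<Rightarrow> 'b"
  assumes "finite S" "finite T" "T \<noteq> {}" "f ` S \<subseteq> T"
  shows "\<exists>y \<in> T. real (card {x \<in> S. f x = y}) \<ge> real (card S) / real (card T)"
proof (rule ccontr)
  assume "\<not> ?thesis"
  then have less: "\<And>y. y \<in> T \<Longrightarrow> real (card {x \<in> S. f x = y}) < real (card S) / real (card T)"
    by (auto simp: not_le)
  have "card S = (\<Sum>y\<in>T. card {x \<in> S. f x = y})"
    using sum.group[OF assms(1,2,4), of "\<lambda>_. 1::nat"] by simp
  then have "real (card S) = (\<Sum>y\<in>T. real (card {x \<in> S. f x = y}))" by simp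
  also have "\<dots> < (\<Sum>y\<in>T. real (card S) / real (card T))"
    using assms less by (intro sum_strict_mono) auto
  also have "\<dots> = real (card S)" using assms by simp
  finally show False by simp
qed

text \<open>Cauchy-Schwarz for the fibre sizes: they sum to \<open>card A\<close>, and the sum of
  their squares counts the colliding pairs, diagonal included.\<close>

lemma card_square_le_image_collisions:
  fixes f :: "'a \<Rightarrow> 'b"
  assumes "finite A"
  shows "(card A)\<^sup>2 \<le> card (f ` A) * card {(p, q) \<in> A \<times> A. f p = f q}"
proof -
  let ?F = "\<lambda>y. {x \<in> A. f x = y}"
  have "card A = (\<Sum>y\<in>f ` A. card (?F y))"
    using sum.group[OF assms _ order_refl, of f "\<lambda>_. 1::nat"] assms by simp
  then have "(real (card A))\<^sup>2 = (\<Sum>y\<in>f ` A. real (card (?F y)))\<^sup>2" by simp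
  also have "\<dots> \<le> real (card (f ` A)) * (\<Sum>y\<in>f ` A. (real (card (?F y)))\<^sup>2)"
    using sum_squared_le_sum_of_squares[of "\<lambda>y. real (card (?F y))" "f ` A"] by (simp add: mult.commute)
  also have "(\<Sum>y\<in>f ` A. (real (card (?F y)))\<^sup>2) = real (card {(p, q) \<in> A \<times> A. f p = f q})"
  proof -
    have "{(p, q) \<in> A \<times> A. f p = f q} = (\<Union>y\<in>f ` A. ?F y \<times> ?F y)" by auto
    moreover have "card (\<Union>y\<in>f ` A. ?F y \<times> ?F y) = (\<Sum>y\<in>f ` A. card (?F y \<times> ?F y))"
      using assms by (intro card_UN_disjoint) auto
    ultimately show ?thesis by (simp add: card_cartesian_product power2_eq_square)
  qed
  finally show ?thesis unfolding of_nat_mult[symmetric] of_nat_power[symmetric] of_nat_le_iff .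
qed

text \<open>Pigeonhole over the 9 residue classes of tiles and the levels;
  \<open>117 = 9 * 13\<close>.\<close>

lemma convex_subset_from_labels:
  fixes A :: "(real ^ 3) set"
  assumes r: "r \<ge> 1" and fin: "finite A" and box: "\<And>p c. p \<in> A \<Longrightarrow> 0 \<le> p $ c \<and> p $ c \<le> r ^ 4"
    and ij: "real i \<le> r ^ 3" "real j \<le> r ^ 3"
  shows "\<exists>B \<subseteq> A. convex_position B \<and>
    real (card B) \<ge> real (card (cap_label r i j ` A)) / (117 * r ^ 6)"
proof -
  let ?L = "cap_label r i j"
  let ?f = "\<lambda>(k, l, m). (k mod 3, l mod 3, m) :: int \<times> int \<times> int"
  let ?I = "{\<lfloor>- 8 * r ^ 6\<rfloor>..\<lfloor>3 * r ^ 6\<rfloor>}"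
  let ?T = "{0..2::int} \<times> {0..2::int} \<times> ?I"
  have r6: "r ^ 6 \<ge> 1" using r by simp
  \<comment> \<open>There are at most \<open>11 * r ^ 6 + 2\<close> levels, the 2 coming from
    rounding and the closed range.\<close>
  have I: "real (card ?I) \<le> 13 * r ^ 6" using r6 by simp linarith
  have ne: "?I \<noteq> {}" using r6 by (simp add: floor_mono)
  have cT: "card ?T > 0" using ne by (simp add: card_gt_0_iff card_cartesian_product)
  have cTle: "real (card ?T) \<le> 117 * r ^ 6" using I by (simp add: card_cartesian_product)
  have "?f ` (?L ` A) \<subseteq> ?T"
  proof
    fix x assume "x \<in> ?f ` (?L ` A)"
    then obtain k l m p where x: "x = (k mod 3, l mod 3, m)" and p: "?L p = (k, l, m)" "p \<in> A"
      by (auto split: prod.splits)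
    have "m \<in> ?I"
      using tangent_height_level_bounds[OF r box[OF p(2)] ij] p(1) by (metis snd_conv)
    moreover have "k mod 3 \<in> {0..2}" "l mod 3 \<in> {0..2}" by auto
    ultimately show "x \<in> ?T" unfolding x by blast
  qed
  then obtain y where y: "y \<in> ?T"
      "real (card {x \<in> ?L ` A. ?f x = y}) \<ge> real (card (?L ` A)) / real (card ?T)"
    using large_fibre_exists[of "?L ` A" ?T ?f] fin cT by (auto simp: card_gt_0_iff)
  let ?S = "{x \<in> ?L ` A. ?f x = y}"
  \<comment> \<open>One representative point for each label in the popular class.\<close>
  define B where "B = inv_into A ?L ` ?S"
  have S: "?S \<subseteq> ?L ` A" by auto
  have BA: "B \<subseteq> A" unfolding B_def by (auto intro: inv_into_into)
  have LB: "?L ` B = ?S" unfolding B_def by (rule image_inv_into_cancel[OF refl S])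
  have cB: "card B = card ?S"
    unfolding B_def by (rule card_image) (rule inj_on_inv_into[OF S])
  have finB: "finite B" using BA fin finite_subset by blast
  have inj: "inj_on ?L B" by (rule eq_card_imp_inj_on[OF finB]) (simp add: LB cB)
  obtain s t m where yst: "y = (s, t, m)" by (cases y) auto
  have "convex_position B"
  proof (rule convex_position_same_level[OF _ finB inj])
    fix p assume "p \<in> B"
    then have "?L p \<in> ?S" using LB by blast
    then have "?f (?L p) = (s, t, m)" using yst by auto
    then show "\<lfloor>p $ 1 / r\<rfloor> mod 3 = s \<and> \<lfloor>p $ 2 / r\<rfloor> mod 3 = t \<and> snd (snd (?L p)) = m"
      by (simp add: cap_label_def Let_def)
  qed (use r in simp)
  moreover have "real (card (?L ` A)) / (117 * r ^ 6) \<le> real (card (?L ` A)) / real (card ?T)"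
    using cTle cT r6 by (intro divide_left_mono mult_pos_pos) auto
  ultimately show ?thesis using BA y(2) cB by (intro exI[of _ B]) auto
qed

section \<open>Shifts under which two points share a cell\<close>

lemma card_nat_in_open_interval:
  fixes a b :: real
  assumes "\<And>i. i \<in> S \<Longrightarrow> a < real i \<and> real i < b" and "a \<le> b"
  shows "real (card S) \<le> b - a + 1"
proof -
  have "int ` S \<subseteq> {\<lfloor>a\<rfloor> + 1..\<lceil>b\<rceil> - 1}"
  proof
    fix x assume "x \<in> int ` S"
    then obtain i where "x = int i" "i \<in> S" by auto
    then have "a < real_of_int x" "real_of_int x < b" using assms(1) by auto
    then show "x \<in> {\<lfloor>a\<rfloor> + 1..\<lceil>b\<rceil> - 1}" by simp linarith
  qed
  then have "card (int ` S) \<le> card {\<lfloor>a\<rfloor> + 1..\<lceil>b\<rceil> - 1}" by (intro card_mono) auto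
  moreover have "card (int ` S) = card S" by (simp add: card_image)
  ultimately have "card S \<le> nat (\<lceil>b\<rceil> - 1 - \<lfloor>a\<rfloor>)" by simp
  then show ?thesis using assms(2) by linarith
qed

text \<open>The admissible \<open>i\<close> lie in an open interval of length
  \<open>r / \<bar>u\<bar>\<close>; since this length is at least 1, doubling it absorbs the extra 1
  in the count of integers.\<close>

lemma card_shifts_small_value:
  fixes e r u :: real and M :: nat
  assumes r: "r > 0" and u: "u \<noteq> 0" "\<bar>u\<bar> \<le> r"
  shows "real (card {i \<in> {..<M}. \<bar>e - 2 * r * u * real i\<bar> < r\<^sup>2}) \<le> 2 * r / \<bar>u\<bar>"
proof -
  let ?x = "e / (2 * r * u)" and ?d = "r / (2 * \<bar>u\<bar>)"
  have "real (card {i \<in> {..<M}. \<bar>e - 2 * r * u * real i\<bar> < r\<^sup>2}) \<le> (?x + ?d) - (?x - ?d) + 1"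
  proof (rule card_nat_in_open_interval)
    fix i assume "i \<in> {i \<in> {..<M}. \<bar>e - 2 * r * u * real i\<bar> < r\<^sup>2}"
    then have "\<bar>e - 2 * r * u * real i\<bar> < r\<^sup>2" by simp
    moreover have "e - 2 * r * u * real i = 2 * r * u * (?x - real i)"
      using r u by (simp add: field_simps)
    ultimately have "(2 * r * \<bar>u\<bar>) * \<bar>?x - real i\<bar> < r\<^sup>2" using r by (simp add: abs_mult)
    then have "\<bar>?x - real i\<bar> < r\<^sup>2 / (2 * r * \<bar>u\<bar>)" using r u by (simp add: field_simps)
    also have "\<dots> = ?d" using r by (simp add: power2_eq_square)
    finally show "?x - ?d < real i \<and> real i < ?x + ?d" by linarith
  qed (use r u in auto)
  also have "\<dots> = r / \<bar>u\<bar> + 1" by simp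
  also have "\<dots> \<le> 2 * r / \<bar>u\<bar>" using u by (simp add: le_divide_eq distrib_right)
  finally show ?thesis .
qed

lemma floor_eq_imp_close:
  fixes x y c :: real
  assumes "c > 0" "\<lfloor>x / c\<rfloor> = \<lfloor>y / c\<rfloor>"
  shows "\<bar>y - x\<bar> < c"
  using floor_divide_bounds[OF assms(1), of x] floor_divide_bounds[OF assms(1), of y] assms(2)
  by (simp add: abs_less_iff)

text \<open>Points with equal labels are measured against the same tangent plane, so the difference
  of their heights is linear in \<open>q - p\<close>, and it is smaller than one level.\<close>

lemma same_label_imp:
  fixes p q :: "real ^ 3"
  assumes r: "r > 0" and eq: "cap_label r i j p = cap_label r i j q"
  defines "k \<equiv> \<lfloor>p $ 1 / r\<rfloor>" and "l \<equiv> \<lfloor>p $ 2 / r\<rfloor>"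
  shows "\<bar>q $ 1 - p $ 1\<bar> < r" "\<bar>q $ 2 - p $ 2\<bar> < r"
    "\<bar>r ^ 4 * (q $ 3 - p $ 3) - 2 * (r * (k + i)) * (q $ 1 - p $ 1)
       - 2 * (r * (l + j)) * (q $ 2 - p $ 2)\<bar> < r\<^sup>2"
proof -
  have k: "\<lfloor>q $ 1 / r\<rfloor> = k" "\<lfloor>q $ 2 / r\<rfloor> = l"
    and h: "\<lfloor>tangent_height r k l i j p / r\<^sup>2\<rfloor> = \<lfloor>tangent_height r k l i j q / r\<^sup>2\<rfloor>"
    using eq by (auto simp: cap_label_def Let_def k_def l_def)
  show "\<bar>q $ 1 - p $ 1\<bar> < r" "\<bar>q $ 2 - p $ 2\<bar> < r"
    using floor_eq_imp_close[OF r] k by (auto simp: k_def l_def)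
  have "tangent_height r k l i j q - tangent_height r k l i j p =
      r ^ 4 * (q $ 3 - p $ 3) - 2 * (r * (k + i)) * (q $ 1 - p $ 1)
       - 2 * (r * (l + j)) * (q $ 2 - p $ 2)"
    unfolding tangent_height_def by (simp add: algebra_simps)
  then show "\<bar>r ^ 4 * (q $ 3 - p $ 3) - 2 * (r * (k + i)) * (q $ 1 - p $ 1)
       - 2 * (r * (l + j)) * (q $ 2 - p $ 2)\<bar> < r\<^sup>2"
    using floor_eq_imp_close[OF _ h] r by simp
qed

text \<open>The displacement is nearly parallel to a tangent plane of bounded slope, so a small
  horizontal part would force a small vertical part, against the minimum distance.\<close>

lemma same_label_displacement:
  fixes p q :: "real ^ 3"
  assumes r: "r \<ge> 1" and box: "\<And>c. 0 \<le> p $ c \<and> p $ c \<le> r ^ 4"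
    and ij: "real i \<le> r ^ 3" "real j \<le> r ^ 3"
    and far: "dist p q \<ge> 11"
    and eq: "cap_label r i j p = cap_label r i j q"
  defines "w \<equiv> max \<bar>q $ 1 - p $ 1\<bar> \<bar>q $ 2 - p $ 2\<bar>"
  shows "1 \<le> w" "w < r" "\<bar>q $ 3 - p $ 3\<bar> < 1 + 8 * w"
proof -
  have r0: "r > 0" using r by simp
  \<comment> \<open>\<open>(a, b)\<close> is the corner of the translated tile, so
    \<open>2 * a\<close> and \<open>2 * b\<close> are \<open>r ^ 4\<close> times the slopes of the
    tangent plane; each slope is at most 4.\<close>
  define a where "a = r * (\<lfloor>p $ 1 / r\<rfloor> + i)"
  define b where "b = r * (\<lfloor>p $ 2 / r\<rfloor> + j)"
  define u where "u = q - p"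
  note same = same_label_imp[OF r0 eq]
  show "w < r" using same(1,2) unfolding w_def by simp
  have slope: "0 \<le> r * (\<lfloor>x / r\<rfloor> + t) \<and> r * (\<lfloor>x / r\<rfloor> + t) \<le> 2 * r ^ 4"
    if "0 \<le> x" "x \<le> r ^ 4" "real t \<le> r ^ 3" for x :: real and t :: nat
  proof -
    have "r * t \<le> r * r ^ 3" using that(3) r by (intro mult_left_mono) auto
    also have "\<dots> = r ^ 4" by (simp add: eval_nat_numeral)
    finally have "r * t \<le> r ^ 4" .
    moreover have "0 \<le> \<lfloor>x / r\<rfloor>" using that r0 by simp
    then have "0 \<le> r * \<lfloor>x / r\<rfloor>" using r0 by simp
    moreover have "0 \<le> r * t" using r0 by simp
    ultimately show ?thesis
      using floor_divide_bounds(1)[OF r0, of x] that(2) by (simp add: distrib_left)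
  qed
  have a: "0 \<le> a" "a \<le> 2 * r ^ 4" and b: "0 \<le> b" "b \<le> 2 * r ^ 4"
    unfolding a_def b_def using slope box ij by auto
  have w: "\<bar>u $ 1\<bar> \<le> w" "\<bar>u $ 2\<bar> \<le> w" "0 \<le> w" unfolding w_def u_def by auto
  have au: "\<bar>a * u $ 1\<bar> \<le> 2 * r ^ 4 * w" "\<bar>b * u $ 2\<bar> \<le> 2 * r ^ 4 * w"
    unfolding abs_mult using a b w by (auto intro!: mult_mono)
  have "\<bar>r ^ 4 * u $ 3 - 2 * a * u $ 1 - 2 * b * u $ 2\<bar> < r\<^sup>2"
    using same(3) unfolding a_def b_def u_def by simp
  then have "\<bar>r ^ 4 * u $ 3\<bar> < r\<^sup>2 + 2 * \<bar>a * u $ 1\<bar> + 2 * \<bar>b * u $ 2\<bar>" by linarith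
  also have "r\<^sup>2 \<le> r ^ 4" using r by (intro power_increasing) auto
  finally have "r ^ 4 * \<bar>u $ 3\<bar> < r ^ 4 * (1 + 8 * w)"
    using au r by (simp add: abs_mult distrib_left)
  then have u3: "\<bar>u $ 3\<bar> < 1 + 8 * w" using r0 by simp
  then show "\<bar>q $ 3 - p $ 3\<bar> < 1 + 8 * w" unfolding u_def by simp
  \<comment> \<open>This fixes the minimum distance 11: the three coordinates add up to less than
    \<open>w + w + (1 + 8 * w)\<close>, so \<open>11 < 1 + 10 * w\<close>.\<close>
  have "11 \<le> norm u" using far unfolding u_def by (simp add: dist_norm norm_minus_commute)
  also have "\<dots> \<le> \<bar>u $ 1\<bar> + \<bar>u $ 2\<bar> + \<bar>u $ 3\<bar>"
    using norm_le_l1_cart[of u] by (simp add: sum_3)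
  finally show "1 \<le> w" using u3 w by linarith
qed

text \<open>With one shift index fixed, sharing a cell confines the other to a short interval. There
  are two versions so that the larger horizontal coordinate can serve as divisor.\<close>

lemma card_common_shifts:
  fixes p q :: "real ^ 3" and M :: nat
  assumes r: "r > 0"
  defines "W \<equiv> {(i, j) \<in> {..<M} \<times> {..<M}. cap_label r i j p = cap_label r i j q}"
  shows "q $ 1 \<noteq> p $ 1 \<Longrightarrow> real (card W) \<le> real M * (2 * r / \<bar>q $ 1 - p $ 1\<bar>)"
    and "q $ 2 \<noteq> p $ 2 \<Longrightarrow> real (card W) \<le> real M * (2 * r / \<bar>q $ 2 - p $ 2\<bar>)"
proof -
  let ?k = "\<lfloor>p $ 1 / r\<rfloor>" and ?l = "\<lfloor>p $ 2 / r\<rfloor>"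
  define u where "u = q - p"
  have same: "\<bar>u $ 1\<bar> < r \<and> \<bar>u $ 2\<bar> < r \<and>
      \<bar>r ^ 4 * u $ 3 - 2 * (r * (?k + i)) * u $ 1 - 2 * (r * (?l + j)) * u $ 2\<bar> < r\<^sup>2"
    if "(i, j) \<in> W" for i j
    using same_label_imp[OF r, of i j p q] that unfolding W_def u_def by auto
  have finW: "finite W" unfolding W_def by (rule finite_subset[of _ "{..<M} \<times> {..<M}"]) auto
  { assume ne: "q $ 1 \<noteq> p $ 1"
    show "real (card W) \<le> real M * (2 * r / \<bar>q $ 1 - p $ 1\<bar>)"
    \<comment> \<open>Any common shift places both points in one tile and yields
      \<open>\<bar>u $ 1\<bar> \<le> r\<close>; without a common shift the count is 0.\<close>
    proof (cases "W = {}")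
      case False
      then have ur: "\<bar>u $ 1\<bar> \<le> r" using same by fastforce
      define S where "S = (\<lambda>j. {i \<in> {..<M}.
        \<bar>(r ^ 4 * u $ 3 - 2 * (r * ?k) * u $ 1 - 2 * (r * (?l + j)) * u $ 2) - 2 * r * u $ 1 * real i\<bar> < r\<^sup>2})"
      have "W \<subseteq> prod.swap ` (SIGMA j:{..<M}. S j)"
      proof
        fix x assume x: "x \<in> W"
        obtain i j where ij: "x = (i, j)" by (cases x)
        have "(j, i) \<in> (SIGMA j:{..<M}. S j)"
          using same[of i j] x ij unfolding S_def W_def by (auto simp: algebra_simps)
        then show "x \<in> prod.swap ` (SIGMA j:{..<M}. S j)" using ij by force
      qed
      then have "card W \<le> card (SIGMA j:{..<M}. S j)"
        by (rule surj_card_le[rotated]) (auto simp: S_def)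
      also have "\<dots> = (\<Sum>j<M. card (S j))" by (rule card_SigmaI) (auto simp: S_def)
      finally have "real (card W) \<le> (\<Sum>j<M. real (card (S j)))"
        by (metis of_nat_le_iff of_nat_sum)
      also have "\<dots> \<le> (\<Sum>j<M. 2 * r / \<bar>u $ 1\<bar>)"
        unfolding S_def using ne ur r by (intro sum_mono card_shifts_small_value) (auto simp: u_def)
      finally show ?thesis by (simp add: u_def)
    qed (use r in simp)
  next
    assume ne: "q $ 2 \<noteq> p $ 2"
    show "real (card W) \<le> real M * (2 * r / \<bar>q $ 2 - p $ 2\<bar>)"
    proof (cases "W = {}")
      case False
      then have ur: "\<bar>u $ 2\<bar> \<le> r" using same by fastforce
      define S where "S = (\<lambda>i. {j \<in> {..<M}.
        \<bar>(r ^ 4 * u $ 3 - 2 * (r * (?k + i)) * u $ 1 - 2 * (r * ?l) * u $ 2) - 2 * r * u $ 2 * real j\<bar> < r\<^sup>2})"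
      have "W \<subseteq> (SIGMA i:{..<M}. S i)"
      proof
        fix x assume x: "x \<in> W"
        obtain i j where ij: "x = (i, j)" by (cases x)
        show "x \<in> (SIGMA i:{..<M}. S i)"
          using same[of i j] x ij unfolding S_def W_def by (auto simp: algebra_simps)
      qed
      then have "card W \<le> card (SIGMA i:{..<M}. S i)"
        by (rule card_mono[rotated]) (auto simp: S_def)
      also have "\<dots> = (\<Sum>i<M. card (S i))" by (rule card_SigmaI) (auto simp: S_def)
      finally have "real (card W) \<le> (\<Sum>i<M. real (card (S i)))"
        by (metis of_nat_le_iff of_nat_sum)
      also have "\<dots> \<le> (\<Sum>i<M. 2 * r / \<bar>u $ 2\<bar>)"
        unfolding S_def using ne ur r by (intro sum_mono card_shifts_small_value) (auto simp: u_def)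
      finally show ?thesis by (simp add: u_def)
    qed (use r in simp)
  }
qed

section \<open>Packing bounds for separated points\<close>

text \<open>A half-open unit cube holds at most one point of \<open>Q\<close>: two of them would
  differ by less than 1 in each coordinate, hence have distance less than 3.\<close>

lemma card_separated_le_cells:
  fixes Q :: "(real ^ 3) set" and I :: "3 \<Rightarrow> int set"
  assumes sep: "\<And>x y. x \<in> Q \<Longrightarrow> y \<in> Q \<Longrightarrow> x \<noteq> y \<Longrightarrow> dist x y \<ge> 3"
    and cell: "\<And>x c. x \<in> Q \<Longrightarrow> \<lfloor>(x - p) $ c\<rfloor> \<in> I c"
    and fin: "\<And>c. finite (I c)"
  shows "card Q \<le> card (I 1) * card (I 2) * card (I 3)"
proof -
  let ?f = "\<lambda>x. (\<lfloor>(x - p) $ 1\<rfloor>, \<lfloor>(x - p) $ 2\<rfloor>, \<lfloor>(x - p) $ 3\<rfloor>)"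
  have "inj_on ?f Q"
  proof (rule inj_onI, rule ccontr)
    fix x y assume xy: "x \<in> Q" "y \<in> Q" "?f x = ?f y" "x \<noteq> y"
    have close: "\<bar>s - t\<bar> < 1" if "\<lfloor>s\<rfloor> = \<lfloor>t\<rfloor>" for s t :: real using that by linarith
    have "\<bar>(x - p) $ c - (y - p) $ c\<bar> < 1" if "c \<in> {1, 2, 3}" for c :: 3
      using that xy(3) by (intro close) auto
    then have "\<bar>(x - y) $ 1\<bar> < 1" "\<bar>(x - y) $ 2\<bar> < 1" "\<bar>(x - y) $ 3\<bar> < 1" by auto
    moreover have "dist x y \<le> \<bar>(x - y) $ 1\<bar> + \<bar>(x - y) $ 2\<bar> + \<bar>(x - y) $ 3\<bar>"
      unfolding dist_norm using norm_le_l1_cart[of "x - y"] by (simp only: sum_3)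
    ultimately show False using sep[OF xy(1,2,4)] by linarith
  qed
  then have "card Q \<le> card (I 1 \<times> I 2 \<times> I 3)"
    by (rule card_inj_on_le) (use cell fin in auto)
  then show ?thesis by (simp add: card_cartesian_product)
qed

text \<open>In a shell one horizontal coordinate is confined to constantly many unit intervals,
  while the other two coordinates range over \<open>O(m)\<close>. This gives order
  \<open>m\<^sup>2\<close> instead of \<open>m ^ 3\<close>; the factor 816 is 408 for each choice of
  the confined coordinate.\<close>

lemma card_displacement_shell:
  fixes Q :: "(real ^ 3) set" and p :: "real ^ 3" and m :: nat
  assumes m: "m \<ge> 1"
    and sep: "\<And>x y. x \<in> Q \<Longrightarrow> y \<in> Q \<Longrightarrow> x \<noteq> y \<Longrightarrow> dist x y \<ge> 3"
    and shell: "\<And>q. q \<in> Q \<Longrightarrow> real m \<le> max \<bar>q $ 1 - p $ 1\<bar> \<bar>q $ 2 - p $ 2\<bar>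
        \<and> max \<bar>q $ 1 - p $ 1\<bar> \<bar>q $ 2 - p $ 2\<bar> < real m + 1
        \<and> \<bar>q $ 3 - p $ 3\<bar> < 1 + 8 * max \<bar>q $ 1 - p $ 1\<bar> \<bar>q $ 2 - p $ 2\<bar>"
  shows "real (card Q) \<le> 816 * (real m)\<^sup>2"
proof -
  \<comment> \<open>The value \<open>- int m\<close> is the floor only at the endpoint
    \<open>x = - real m\<close>; other negative values have floor
    \<open>- int m - 1\<close>.\<close>
  define J where "J = {int m, - int m, - int m - 1}"
  define K where "K = {- int m - 1..int m}"
  define L where "L = {- 8 * int m - 9..8 * int m + 8}"
  have J: "card J \<le> 3" unfolding J_def by (simp add: card_insert_if)
  have K: "card K = 2 * m + 2" unfolding K_def by simp
  have L: "card L = 16 * m + 18" unfolding L_def by simp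
  have fin: "finite J" "finite K" "finite L" unfolding J_def K_def L_def by auto
  have inJ: "\<lfloor>x\<rfloor> \<in> J" if "real m \<le> \<bar>x\<bar>" "\<bar>x\<bar> < real m + 1" for x :: real
    unfolding J_def using that by simp linarith
  have inK: "\<lfloor>x\<rfloor> \<in> K" if "\<bar>x\<bar> < real m + 1" for x :: real
    unfolding K_def using that by simp linarith
  have inL: "\<lfloor>x\<rfloor> \<in> L" if "\<bar>x\<bar> < 9 + 8 * real m" for x :: real
    unfolding L_def using that by simp linarith
  have bound: "real (card Q') \<le> 408 * (real m)\<^sup>2" if "card Q' \<le> card J * card K * card L" for Q' :: "(real ^ 3) set"
  proof -
    have "card J * card K * card L \<le> 3 * (4 * m) * (34 * m)"
      using J K L m by (intro mult_mono) auto
    then have "card Q' \<le> 408 * m\<^sup>2" using that by (simp add: power2_eq_square)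
    then have "real (card Q') \<le> real (408 * m\<^sup>2)" by (rule of_nat_mono)
    then show ?thesis by simp
  qed
  define Q1 where "Q1 = {q \<in> Q. real m \<le> \<bar>q $ 1 - p $ 1\<bar>}"
  define Q2 where "Q2 = {q \<in> Q. real m \<le> \<bar>q $ 2 - p $ 2\<bar>}"
  have cells: "\<bar>q $ 1 - p $ 1\<bar> < real m + 1" "\<bar>q $ 2 - p $ 2\<bar> < real m + 1"
      "\<bar>q $ 3 - p $ 3\<bar> < 9 + 8 * real m" if "q \<in> Q" for q
  proof -
    define w where "w = max \<bar>q $ 1 - p $ 1\<bar> \<bar>q $ 2 - p $ 2\<bar>"
    have "\<bar>q $ 1 - p $ 1\<bar> \<le> w" "\<bar>q $ 2 - p $ 2\<bar> \<le> w" unfolding w_def by auto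
    moreover have "w < real m + 1" "\<bar>q $ 3 - p $ 3\<bar> < 1 + 8 * w" using shell[OF that] unfolding w_def by blast+
    ultimately show "\<bar>q $ 1 - p $ 1\<bar> < real m + 1" "\<bar>q $ 2 - p $ 2\<bar> < real m + 1"
      "\<bar>q $ 3 - p $ 3\<bar> < 9 + 8 * real m" by linarith+
  qed
  have 1: "\<lfloor>(q - p) $ c\<rfloor> \<in> (if c = 1 then J else if c = 2 then K else L)" if "q \<in> Q1" for q c
    using that cells[of q] inJ[of "q $ 1 - p $ 1"] inK[of "q $ 2 - p $ 2"] inL[of "q $ 3 - p $ 3"] exhaust_3[of c]
    unfolding Q1_def by auto
  have 2: "\<lfloor>(q - p) $ c\<rfloor> \<in> (if c = 1 then K else if c = 2 then J else L)" if "q \<in> Q2" for q c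
    using that cells[of q] inJ[of "q $ 2 - p $ 2"] inK[of "q $ 1 - p $ 1"] inL[of "q $ 3 - p $ 3"] exhaust_3[of c]
    unfolding Q2_def by auto
  have "card Q1 \<le> card J * card K * card L"
    using card_separated_le_cells[of Q1, OF _ 1] sep fin unfolding Q1_def by simp
  moreover have "card Q2 \<le> card J * card K * card L"
    using card_separated_le_cells[of Q2, OF _ 2] sep fin unfolding Q2_def by (simp add: mult.commute)
  moreover have "card Q \<le> card Q1 + card Q2"
  proof -
    have "Q = Q1 \<union> Q2" unfolding Q1_def Q2_def using shell by (force simp: le_max_iff_disj)
    then show ?thesis using card_Un_le by metis
  qed
  ultimately show ?thesis using bound[of Q1] bound[of Q2] by linarith
qed

section \<open>Averaging over the shifts\<close>

text \<open>Group the points by the integer part \<open>k\<close> of their horizontal distance to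
  \<open>p\<close>. A shell has at most \<open>816 * k\<^sup>2\<close> candidates with at most
  \<open>M * 2 * r / k\<close> common shifts each, so it contributes \<open>O(M * r * k)\<close>;
  summing over \<open>k \<le> r\<close> gives \<open>O(M * r ^ 3)\<close>, which is
  \<open>O(M\<^sup>2)\<close>.\<close>

lemma sum_common_shifts_le:
  fixes A :: "(real ^ 3) set" and p :: "real ^ 3" and M :: nat
  assumes r: "r \<ge> 1" and fin: "finite A"
    and box: "\<And>c. 0 \<le> p $ c \<and> p $ c \<le> r ^ 4"
    and sep: "\<And>x y. x \<in> insert p A \<Longrightarrow> y \<in> insert p A \<Longrightarrow> x \<noteq> y \<Longrightarrow> dist x y \<ge> 11"
    and M: "r ^ 3 \<le> real M" "\<And>i. i < M \<Longrightarrow> real i \<le> r ^ 3"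
  defines "W \<equiv> \<lambda>q. {(i, j) \<in> {..<M} \<times> {..<M}. cap_label r i j p = cap_label r i j q}"
  shows "(\<Sum>q\<in>A - {p}. real (card (W q))) \<le> 1632 * (real M)\<^sup>2"
proof -
  define w where "w = (\<lambda>q :: real ^ 3. max \<bar>q $ 1 - p $ 1\<bar> \<bar>q $ 2 - p $ 2\<bar>)"
  define m where "m = (\<lambda>q. nat \<lfloor>w q\<rfloor>)"
  define R where "R = nat \<lfloor>r\<rfloor>"
  \<comment> \<open>The candidates: points that share a cell with \<open>p\<close> under at least
    one shift. All others contribute 0.\<close>
  define Q where "Q = {q \<in> A - {p}. W q \<noteq> {}}"
  have finQ: "finite Q" unfolding Q_def using fin by simp
  have near: "1 \<le> w q \<and> w q < r \<and> \<bar>q $ 3 - p $ 3\<bar> < 1 + 8 * w q" if q: "q \<in> Q" for q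
  proof -
    obtain i j where ij: "i < M" "j < M" "cap_label r i j p = cap_label r i j q"
      using q unfolding Q_def W_def by auto
    have "dist p q \<ge> 11" using q sep[of p q] unfolding Q_def by auto
    from same_label_displacement[OF r box M(2)[OF ij(1)] M(2)[OF ij(2)] this ij(3)]
    show ?thesis unfolding w_def by blast
  qed
  have m: "1 \<le> m q" "m q \<le> R" "real (m q) \<le> w q" "w q < real (m q) + 1" if "q \<in> Q" for q
    using near[OF that] unfolding m_def R_def by linarith+
  have R: "real R \<le> r" using r unfolding R_def by linarith
  have card_W: "real (card (W q)) \<le> real M * (2 * r / real (m q))" if q: "q \<in> Q" for q
  proof -
    have w1: "1 \<le> w q" using near[OF q] by simp
    have r0: "r > 0" using r by simp
    have "real (card (W q)) \<le> real M * (2 * r / w q)"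
    proof (cases "\<bar>q $ 1 - p $ 1\<bar> \<ge> \<bar>q $ 2 - p $ 2\<bar>")
      case True
      then have "w q = \<bar>q $ 1 - p $ 1\<bar>" by (simp add: w_def)
      then show ?thesis using card_common_shifts(1)[OF r0, of q p M] w1 unfolding W_def by auto
    next
      case False
      then have "w q = \<bar>q $ 2 - p $ 2\<bar>" by (simp add: w_def)
      then show ?thesis using card_common_shifts(2)[OF r0, of q p M] w1 unfolding W_def by auto
    qed
    also have "\<dots> \<le> real M * (2 * r / real (m q))"
      using m[OF q] w1 r by (intro mult_left_mono divide_left_mono) auto
    finally show ?thesis .
  qed
  have shell: "real (card {q \<in> Q. m q = k}) \<le> 816 * (real k)\<^sup>2" if k: "k \<in> {1..R}" for k
  proof (rule card_displacement_shell)
    fix q assume "q \<in> {q \<in> Q. m q = k}"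
    then show "real k \<le> max \<bar>q $ 1 - p $ 1\<bar> \<bar>q $ 2 - p $ 2\<bar>
        \<and> max \<bar>q $ 1 - p $ 1\<bar> \<bar>q $ 2 - p $ 2\<bar> < real k + 1
        \<and> \<bar>q $ 3 - p $ 3\<bar> < 1 + 8 * max \<bar>q $ 1 - p $ 1\<bar> \<bar>q $ 2 - p $ 2\<bar>"
      using near[of q] m[of q] unfolding w_def by auto
  next
    fix x y assume "x \<in> {q \<in> Q. m q = k}" "y \<in> {q \<in> Q. m q = k}" "x \<noteq> y"
    then show "dist x y \<ge> 3" using sep[of x y] unfolding Q_def by auto
  qed (use k in simp)
  have "(\<Sum>q\<in>A - {p}. real (card (W q))) = (\<Sum>q\<in>Q. real (card (W q)))"
    by (rule sum.mono_neutral_right) (use fin in \<open>auto simp: Q_def\<close>)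
  also have "\<dots> \<le> (\<Sum>q\<in>Q. real M * (2 * r / real (m q)))" using card_W by (rule sum_mono)
  also have "\<dots> = (\<Sum>k\<in>{1..R}. \<Sum>q\<in>{q \<in> Q. m q = k}. real M * (2 * r / real (m q)))"
    by (rule sum.group[symmetric]) (use finQ m in auto)
  also have "\<dots> = (\<Sum>k\<in>{1..R}. real (card {q \<in> Q. m q = k}) * (real M * (2 * r / real k)))"
    by (rule sum.cong) auto
  also have "\<dots> \<le> (\<Sum>k\<in>{1..R}. 1632 * real M * r * real R)"
  proof (rule sum_mono)
    fix k assume k: "k \<in> {1..R}"
    have "real (card {q \<in> Q. m q = k}) * (real M * (2 * r / real k))
        \<le> 816 * (real k)\<^sup>2 * (real M * (2 * r / real k))"
      using shell[OF k] r by (intro mult_right_mono) auto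
    also have "\<dots> = 1632 * real M * r * real k" using k by (simp add: power2_eq_square)
    also have "\<dots> \<le> 1632 * real M * r * real R" using k r by (intro mult_left_mono) auto
    finally show "real (card {q \<in> Q. m q = k}) * (real M * (2 * r / real k))
        \<le> 1632 * real M * r * real R" .
  qed
  also have "\<dots> = 1632 * real M * (r * (real R * real R))" by simp
  also have "\<dots> \<le> 1632 * real M * (r * (r * r))"
    using R r by (intro mult_left_mono mult_mono) auto
  also have "\<dots> = 1632 * real M * r ^ 3" by (simp add: eval_nat_numeral)
  also have "\<dots> \<le> 1632 * real M * real M" using M(1) by (intro mult_left_mono) auto
  finally show ?thesis by (simp add: power2_eq_square)
qed

lemma card_filter_eq_sum:
  assumes "finite S"
  shows "real (card {x \<in> S. P x}) = (\<Sum>x\<in>S. if P x then 1 else 0)"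
  using assms by (simp add: sum.If_cases Int_def)

text \<open>Double counting of shifts and colliding pairs: each \<open>p\<close> accounts for at
  most \<open>1632 * M\<^sup>2\<close> collisions with other points and exactly
  \<open>M\<^sup>2\<close> with itself. Some shift among the \<open>M\<^sup>2\<close> does no worse
  than the average.\<close>

lemma few_collisions_shift_exists:
  fixes A :: "(real ^ 3) set"
  assumes r: "r \<ge> 1" and fin: "finite A"
    and box: "\<And>p c. p \<in> A \<Longrightarrow> 0 \<le> p $ c \<and> p $ c \<le> r ^ 4"
    and sep: "\<And>x y. x \<in> A \<Longrightarrow> y \<in> A \<Longrightarrow> x \<noteq> y \<Longrightarrow> dist x y \<ge> 11"
  shows "\<exists>i j. real i \<le> r ^ 3 \<and> real j \<le> r ^ 3 \<and>
    real (card {(p, q) \<in> A \<times> A. cap_label r i j p = cap_label r i j q}) \<le> 1633 * real (card A)"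
proof -
  \<comment> \<open>Rounding up gives \<open>r ^ 3 \<le> M\<close>, while every index below
    \<open>M\<close> still is at most \<open>r ^ 3\<close>.\<close>
  define M where "M = nat \<lceil>r ^ 3\<rceil>"
  have r3: "r ^ 3 \<ge> 1" using r by simp
  have M: "r ^ 3 \<le> real M" "\<And>i. i < M \<Longrightarrow> real i \<le> r ^ 3" "M > 0"
    using r3 unfolding M_def by linarith+
  define E where "E = (\<lambda>i j p q. if cap_label r i j p = cap_label r i j q then 1 else 0 :: real)"
  let ?W = "\<lambda>p q. {(i, j) \<in> {..<M} \<times> {..<M}. cap_label r i j p = cap_label r i j q}"
  let ?P = "\<lambda>i j. {(p, q) \<in> A \<times> A. cap_label r i j p = cap_label r i j q}"
  have W: "real (card (?W p q)) = (\<Sum>(i, j)\<in>{..<M} \<times> {..<M}. E i j p q)" for p q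
  proof -
    have "?W p q = {x \<in> {..<M} \<times> {..<M}. cap_label r (fst x) (snd x) p = cap_label r (fst x) (snd x) q}"
      by auto
    then show ?thesis unfolding E_def case_prod_unfold by (simp only:) (rule card_filter_eq_sum, simp)
  qed
  have P: "real (card (?P i j)) = (\<Sum>(p, q)\<in>A \<times> A. E i j p q)" for i j
  proof -
    have "?P i j = {x \<in> A \<times> A. cap_label r i j (fst x) = cap_label r i j (snd x)}"
      by auto
    then show ?thesis
      unfolding E_def case_prod_unfold by (simp only:) (rule card_filter_eq_sum, simp add: fin)
  qed
  have row: "(\<Sum>q\<in>A. real (card (?W p q))) \<le> 1633 * (real M)\<^sup>2" if p: "p \<in> A" for p
  proof -
    have "(\<Sum>q\<in>A - {p}. real (card (?W p q))) \<le> 1632 * (real M)\<^sup>2"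
      by (rule sum_common_shifts_le[OF r fin box[OF p] _ M(1,2)])
        (use sep p in \<open>auto simp: insert_absorb\<close>)
    moreover have "real (card (?W p p)) = (real M)\<^sup>2"
    proof -
      have "?W p p = {..<M} \<times> {..<M}" by auto
      then show ?thesis by (simp only: card_cartesian_product) (simp add: power2_eq_square)
    qed
    ultimately show ?thesis using fin p by (simp add: sum.remove)
  qed
  have total: "(\<Sum>(i, j)\<in>{..<M} \<times> {..<M}. real (card (?P i j))) \<le> real (card A) * (1633 * (real M)\<^sup>2)"
  proof -
    have "(\<Sum>(i, j)\<in>{..<M} \<times> {..<M}. real (card (?P i j)))
        = (\<Sum>(p, q)\<in>A \<times> A. real (card (?W p q)))"
      unfolding P W unfolding case_prod_unfold by (rule sum.swap)
    also have "\<dots> = (\<Sum>p\<in>A. \<Sum>q\<in>A. real (card (?W p q)))"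
      by (rule sum.cartesian_product[symmetric])
    also have "\<dots> \<le> (\<Sum>p\<in>A. 1633 * (real M)\<^sup>2)" using row by (rule sum_mono)
    finally show ?thesis by simp
  qed
  have "\<exists>i<M. \<exists>j<M. real (card (?P i j)) \<le> 1633 * real (card A)"
  proof (rule ccontr)
    assume "\<not> ?thesis"
    then have big: "\<And>i j. i < M \<Longrightarrow> j < M \<Longrightarrow> real (card (?P i j)) > 1633 * real (card A)"
      by (meson not_le)
    have "(\<Sum>(i, j)\<in>{..<M} \<times> {..<M}. 1633 * real (card A))
        < (\<Sum>(i, j)\<in>{..<M} \<times> {..<M}. real (card (?P i j)))"
      using big M(3) by (intro sum_strict_mono) (auto simp: lessThan_empty_iff)
    also note total
    finally show False by (simp add: case_prod_unfold card_cartesian_product power2_eq_square)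
  qed
  then show ?thesis using M(2) by blast
qed

section \<open>Normalisation and the bound in terms of the spread\<close>

text \<open>Few collisions mean at least \<open>card A / 1633\<close> occupied cells by
  Cauchy-Schwarz, and the pigeonhole costs \<open>117 * r ^ 6\<close>;
  \<open>191061 = 1633 * 117\<close>.\<close>

lemma normalized_convex_subset:
  fixes A :: "(real ^ 3) set"
  assumes r: "r \<ge> 1" and fin: "finite A"
    and box: "\<And>p c. p \<in> A \<Longrightarrow> 0 \<le> p $ c \<and> p $ c \<le> r ^ 4"
    and sep: "\<And>x y. x \<in> A \<Longrightarrow> y \<in> A \<Longrightarrow> x \<noteq> y \<Longrightarrow> dist x y \<ge> 11"
  shows "\<exists>B \<subseteq> A. convex_position B \<and> real (card B) \<ge> real (card A) / (191061 * r ^ 6)"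
proof -
  obtain i j where ij: "real i \<le> r ^ 3" "real j \<le> r ^ 3"
    and few: "real (card {(p, q) \<in> A \<times> A. cap_label r i j p = cap_label r i j q}) \<le> 1633 * real (card A)"
    using few_collisions_shift_exists[OF r fin box sep] by blast
  let ?N = "card (cap_label r i j ` A)"
  have "real (card A) / 1633 \<le> real ?N"
  proof (cases "A = {}")
    case False
    have "(real (card A))\<^sup>2 \<le> real ?N * real (card {(p, q) \<in> A \<times> A. cap_label r i j p = cap_label r i j q})"
      unfolding of_nat_mult[symmetric] of_nat_power[symmetric] of_nat_le_iff
      by (rule card_square_le_image_collisions[OF fin])
    also have "\<dots> \<le> real ?N * (1633 * real (card A))" using few by (intro mult_left_mono) auto
    finally have "real (card A) * real (card A) \<le> (1633 * real ?N) * real (card A)"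
      by (simp add: power2_eq_square mult_ac)
    then show ?thesis using False fin by (simp add: mult_le_cancel_right card_gt_0_iff)
  qed simp
  then have "real (card A) / 1633 / (117 * r ^ 6) \<le> real ?N / (117 * r ^ 6)"
    using r by (intro divide_right_mono) auto
  moreover have "real (card A) / 1633 / (117 * r ^ 6) = real (card A) / (191061 * r ^ 6)" by simp
  moreover obtain B where "B \<subseteq> A" "convex_position B" "real ?N / (117 * r ^ 6) \<le> real (card B)"
    using convex_subset_from_labels[OF r fin box ij] by blast
  ultimately show ?thesis by (intro exI[of _ B]) auto
qed

text \<open>Here \<open>d\<close> is the minimum distance, so \<open>d * spread A\<close> is the
  diameter; two points make the set of distances nonempty.\<close>

lemma spread_bounds:
  fixes A :: "(real ^ 3) set"
  assumes fin: "finite A" and two: "card A \<ge> 2"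
  obtains d where "d > 0" "spread A \<ge> 1"
    and "\<And>x y. x \<in> A \<Longrightarrow> y \<in> A \<Longrightarrow> x \<noteq> y \<Longrightarrow> d \<le> dist x y"
    and "\<And>x y. x \<in> A \<Longrightarrow> y \<in> A \<Longrightarrow> dist x y \<le> d * spread A"
proof -
  let ?X = "{dist x y | x y. x \<in> A \<and> y \<in> A \<and> x \<noteq> y}"
  have "?X \<subseteq> (\<lambda>(x, y). dist x y) ` (A \<times> A)" by auto
  then have finX: "finite ?X" using fin finite_subset by blast
  obtain a b where ab: "a \<in> A" "b \<in> A" "a \<noteq> b"
    using two by (metis card_le_Suc0_iff_eq fin not_less_eq_eq numeral_2_eq_2)
  then have ne: "?X \<noteq> {}" by blast
  have "Min ?X \<in> ?X" by (rule Min_in[OF finX ne])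
  then have pos: "Min ?X > 0" by auto
  have min: "Min ?X \<le> dist x y" "dist x y \<le> Max ?X" if "x \<in> A" "y \<in> A" "x \<noteq> y" for x y
    using that finX by (auto intro!: Min_le Max_ge)
  have le: "Min ?X \<le> Max ?X" using min[OF ab] by linarith
  have spread: "Min ?X * spread A = Max ?X" using pos unfolding spread_def by simp
  show ?thesis
  proof (rule that[of "Min ?X"])
    show "spread A \<ge> 1" using le pos unfolding spread_def by simp
    show "dist x y \<le> Min ?X * spread A" if "x \<in> A" "y \<in> A" for x y
      unfolding spread using min[OF that] pos le by (cases "x = y") auto
  qed (use pos min in auto)
qed

text \<open>Scaling by \<open>11 / d\<close> makes the minimum distance 11 and the diameter
  \<open>D = 11 * spread A\<close>. With \<open>D = r ^ 4\<close> the loss \<open>r ^ 6\<close>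
  becomes \<open>D powr (3 / 2)\<close>.\<close>

lemma convex_subset_of_bounded_spread:
  fixes A :: "(real ^ 3) set"
  assumes fin: "finite A" and two: "card A \<ge> 2"
  shows "\<exists>B \<subseteq> A. convex_position B \<and>
    real (card B) \<ge> real (card A) / (191061 * (11 * spread A) powr (3 / 2))"
proof -
  obtain d where d: "d > 0" and sp: "spread A \<ge> 1"
    and far: "\<And>x y. x \<in> A \<Longrightarrow> y \<in> A \<Longrightarrow> x \<noteq> y \<Longrightarrow> d \<le> dist x y"
    and near: "\<And>x y. x \<in> A \<Longrightarrow> y \<in> A \<Longrightarrow> dist x y \<le> d * spread A"
    using spread_bounds[OF fin two] by blast
  have ne: "A \<noteq> {}" using two by auto
  define D where "D = 11 * spread A"
  define r where "r = D powr (1 / 4)"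
  define s where "s = 11 / d"
  \<comment> \<open>The lower corner of the bounding box, in general not a point of
    \<open>A\<close>. Each coordinate is attained by some point of \<open>A\<close>, so the side
    lengths of the box are bounded by the diameter.\<close>
  define a :: "real ^ 3" where "a = (\<chi> c. Min ((\<lambda>p. p $ c) ` A))"
  define T where "T = (\<lambda>x. s *\<^sub>R (x - a))"
  have D: "D \<ge> 11" using sp unfolding D_def by simp
  have s: "s > 0" using d unfolding s_def by simp
  have r: "r \<ge> 1" unfolding r_def using D by (intro ge_one_powr_ge_zero) auto
  have rpow: "r ^ k = D powr (real k / 4)" for k
    unfolding r_def using D by (simp add: powr_powr flip: powr_realpow)
  have r4: "r ^ 4 = D" and r6: "r ^ 6 = D powr (3 / 2)" using D by (simp_all add: rpow)
  have injT: "inj_on T A" using s unfolding T_def by (auto simp: inj_on_def)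
  have distT: "dist (T x) (T y) = s * dist x y" for x y
    using s unfolding T_def by (simp add: dist_norm flip: scaleR_diff_right)
  have box: "0 \<le> q $ c \<and> q $ c \<le> r ^ 4" if q: "q \<in> T ` A" for q c
  proof -
    obtain p where p: "p \<in> A" "q = T p" using q by auto
    have "Min ((\<lambda>p. p $ c) ` A) \<in> (\<lambda>p. p $ c) ` A" using fin ne by (intro Min_in) auto
    then obtain p' where p': "p' \<in> A" "a $ c = p' $ c" unfolding a_def by auto
    have "a $ c \<le> p $ c" using fin p(1) unfolding a_def by simp
    moreover have "p $ c - a $ c \<le> d * spread A"
      using near[OF p(1) p'(1)] component_le_norm_cart[of "p - p'" c] p'(2)
      unfolding dist_norm by simp
    then have "s * (p $ c - a $ c) \<le> s * (d * spread A)" using s by (intro mult_left_mono) auto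
    moreover have "s * (d * spread A) = D" using d unfolding s_def D_def by simp
    ultimately show ?thesis unfolding p(2) T_def r4 using s by simp
  qed
  have sep: "dist x y \<ge> 11" if xy: "x \<in> T ` A" "y \<in> T ` A" "x \<noteq> y" for x y
  proof -
    obtain p q where pq: "p \<in> A" "q \<in> A" "x = T p" "y = T q" "p \<noteq> q" using xy by blast
    have "s * d \<le> s * dist p q" using far[OF pq(1,2,5)] s by (intro mult_left_mono) auto
    then show ?thesis using d unfolding pq(3,4) distT by (simp add: s_def)
  qed
  obtain B' where B': "B' \<subseteq> T ` A" "convex_position B'"
      "real (card B') \<ge> real (card (T ` A)) / (191061 * r ^ 6)"
    using normalized_convex_subset[OF r finite_imageI[OF fin] box sep] by blast
  then obtain B where B: "B \<subseteq> A" "B' = T ` B" by (meson subset_imageE)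
  have "card B' = card B" "card (T ` A) = card A"
    using B injT by (auto intro!: card_image inj_on_subset[OF injT])
  moreover have "convex_position ((\<lambda>x. s *\<^sub>R (x - a)) ` B)" using B'(2) unfolding B(2) T_def .
  then have "convex_position B" by (rule convex_position_of_affine_image) (use s in simp)
  ultimately show ?thesis using B(1) B'(3) unfolding r6 D_def by (intro exI[of _ B]) auto
qed

theorem theorem5:
  fixes \<alpha> \<tau> :: real
  assumes "\<alpha> > 0" and "1 / 3 \<le> \<tau>" and "\<tau> < 2 / 3"
  shows "\<exists>\<beta>::real. \<beta> > 0 \<and>
    (\<forall>(n::nat) (A::(real ^ 3) set).
       finite A \<and> card A = n \<and> general_position A \<and> spread A \<le> \<alpha> * real n powr \<tau> \<longrightarrow>
       (\<exists>B \<subseteq> A. convex_position B \<and> real (card B) \<ge> \<beta> * real n powr (1 - 3 * \<tau> / 2)))"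
proof -
  define C where "C = 191061 * (11 * \<alpha>) powr (3 / 2)"
  \<comment> \<open>\<open>1 / C\<close> serves for at least two points; the bound 1 covers smaller
    sets, for which \<open>spread\<close> is unspecified.\<close>
  define \<beta> where "\<beta> = min 1 (1 / C)"
  have C: "C > 0" unfolding C_def using assms(1) by simp
  have \<beta>: "\<beta> > 0" "\<beta> \<le> 1" "\<beta> \<le> 1 / C" unfolding \<beta>_def using C by auto
  have "\<exists>B \<subseteq> A. convex_position B \<and> real (card B) \<ge> \<beta> * real n powr (1 - 3 * \<tau> / 2)"
    if A: "finite A" "card A = n" and sp: "spread A \<le> \<alpha> * real n powr \<tau>"
    for n :: nat and A :: "(real ^ 3) set"
  proof (cases "n \<ge> 2")
    case True
    then have n: "real n > 0" by simp
    obtain B where B: "B \<subseteq> A" "convex_position B"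
        "real (card B) \<ge> real n / (191061 * (11 * spread A) powr (3 / 2))"
      using convex_subset_of_bounded_spread[OF A(1)] A(2) True by auto
    have sp1: "spread A \<ge> 1" using spread_bounds[OF A(1)] A(2) True by metis
    \<comment> \<open>The exponent \<open>3 / 2\<close> of the loss turns
      \<open>n powr \<tau>\<close> into \<open>n powr (3 * \<tau> / 2)\<close>.\<close>
    have "(11 * spread A) powr (3 / 2) \<le> (11 * (\<alpha> * real n powr \<tau>)) powr (3 / 2)"
      using sp sp1 by (intro powr_mono2) auto
    also have "\<dots> = ((11 * \<alpha>) * real n powr \<tau>) powr (3 / 2)" by (simp add: mult.assoc)
    also have "\<dots> = (11 * \<alpha>) powr (3 / 2) * real n powr (3 * \<tau> / 2)"
      using assms(1) by (simp add: powr_mult powr_powr mult.commute)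
    finally have "191061 * (11 * spread A) powr (3 / 2) \<le> C * real n powr (3 * \<tau> / 2)"
      unfolding C_def by simp
    then have "real n / (C * real n powr (3 * \<tau> / 2)) \<le> real n / (191061 * (11 * spread A) powr (3 / 2))"
      using sp1 n C by (intro divide_left_mono mult_pos_pos) auto
    moreover have "real n / (C * real n powr (3 * \<tau> / 2)) = 1 / C * real n powr (1 - 3 * \<tau> / 2)"
      using n by (simp add: powr_diff)
    moreover have "\<beta> * real n powr (1 - 3 * \<tau> / 2) \<le> 1 / C * real n powr (1 - 3 * \<tau> / 2)"
      using \<beta>(3) by (intro mult_right_mono) auto
    ultimately have "\<beta> * real n powr (1 - 3 * \<tau> / 2) \<le> real (card B)" using B(3) by linarith
    then show ?thesis using B(1,2) by blast
  next
    case False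
    then have "n = 0 \<or> n = 1" by auto
    moreover have "convex_position A" if "n = 0 \<or> n = 1"
      using that A unfolding convex_position_def by (auto simp: card_1_singleton_iff)
    \<comment> \<open>\<open>A\<close> itself serves: the power of \<open>n\<close> is 0 for
      \<open>n = 0\<close> and 1 for \<open>n = 1\<close>, so \<open>\<beta> \<le> 1\<close> is
      enough.\<close>
    ultimately show ?thesis using A \<beta>(2) by (intro exI[of _ A]) auto
  qed
  then show ?thesis using \<beta>(1) by blast
qed

end
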